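(* Let $m,n,r$ be nonnegative integers. Then $$\mathrm{Tr}(x^my^mx^ny^n)=\mathrm{Tr}(y^mx^my^nx^n)$$ is valid for all $x,y\in\mathbb{H}$. If $m,n,r$ are not distinct (i.e. at least two of them are equal), then $$\mathrm{Tr}(x^my^mx^ny^nx^ry^r)=\mathrm{Tr}(y^mx^my^nx^ny^rx^r)$$ is also valid for all $x,y\in\mathbb{H}$.
   Context: $\mathbb{H}$ is the division ring of real quaternions. For $x\in\mathbb{H}$, $\mathrm{Tr}(x)=x+\bar x=2\,\mathrm{Re}(x)$. *)

theory Defs
  imports Complex_Main
begin

(* Quat a b c d stands for a + b i + c j + d k. *)
datatype quat = Quat (q_re: real) (q_i: real) (q_j: real) (q_k: real)

lemma quat_eq_iff:
  "x = y \<longleftrightarrow> q_re x = q_re y \<and> q_i x = q_i y \<and> q_j x = q_j y \<and> q_k x = q_k y"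
  by (cases x; cases y) simp

instantiation quat :: ab_group_add
begin

definition zero_quat :: quat where "0 = Quat 0 0 0 0"

definition plus_quat :: "quat \<Rightarrow> quat \<Rightarrow> quat" where
  "x + y = Quat (q_re x + q_re y) (q_i x + q_i y) (q_j x + q_j y) (q_k x + q_k y)"

definition uminus_quat :: "quat \<Rightarrow> quat" where
  "- x = Quat (- q_re x) (- q_i x) (- q_j x) (- q_k x)"

definition minus_quat :: "quat \<Rightarrow> quat \<Rightarrow> quat" where
  "x - y = Quat (q_re x - q_re y) (q_i x - q_i y) (q_j x - q_j y) (q_k x - q_k y)"

instance
  by standard (simp_all add: quat_eq_iff zero_quat_def plus_quat_def uminus_quat_def minus_quat_def)

end

instantiation quat :: ring_1
begin

definition one_quat :: quat where "1 = Quat 1 0 0 0"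

(* The bilinear product determined by i^2 = j^2 = k^2 = i j k = -1. *)
definition times_quat :: "quat \<Rightarrow> quat \<Rightarrow> quat" where
  "x * y = Quat
     (q_re x * q_re y - q_i x * q_i y - q_j x * q_j y - q_k x * q_k y)
     (q_re x * q_i y + q_i x * q_re y + q_j x * q_k y - q_k x * q_j y)
     (q_re x * q_j y - q_i x * q_k y + q_j x * q_re y + q_k x * q_i y)
     (q_re x * q_k y + q_i x * q_j y - q_j x * q_i y + q_k x * q_re y)"

instance
  by standard
    (simp_all add: quat_eq_iff zero_quat_def plus_quat_def one_quat_def times_quat_def algebra_simps)

end

definition q_conj :: "quat \<Rightarrow> quat" where
  "q_conj x = Quat (q_re x) (- q_i x) (- q_j x) (- q_k x)"

definition q_norm2 :: "quat \<Rightarrow> real" where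
  "q_norm2 x = (q_re x)\<^sup>2 + (q_i x)\<^sup>2 + (q_j x)\<^sup>2 + (q_k x)\<^sup>2"

lemma q_norm2_eq_0_iff: "q_norm2 x = 0 \<longleftrightarrow> x = 0"
  by (simp add: q_norm2_def quat_eq_iff zero_quat_def add_nonneg_eq_0_iff)

instantiation quat :: real_div_algebra
begin

definition scaleR_quat :: "real \<Rightarrow> quat \<Rightarrow> quat" where
  "a *\<^sub>R x = Quat (a * q_re x) (a * q_i x) (a * q_j x) (a * q_k x)"

definition inverse_quat :: "quat \<Rightarrow> quat" where
  "inverse x = (1 / q_norm2 x) *\<^sub>R q_conj x"

definition divide_quat :: "quat \<Rightarrow> quat \<Rightarrow> quat" where
  "x div y = x * inverse (y :: quat)"

instance
proof
  fix x y :: quat and a b :: real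
  show "a *\<^sub>R (x + y) = a *\<^sub>R x + a *\<^sub>R y" "(a + b) *\<^sub>R x = a *\<^sub>R x + b *\<^sub>R x"
    "a *\<^sub>R b *\<^sub>R x = (a * b) *\<^sub>R x" "1 *\<^sub>R x = x"
    by (simp_all add: quat_eq_iff scaleR_quat_def plus_quat_def algebra_simps)
  show "a *\<^sub>R x * y = a *\<^sub>R (x * y)" "x * a *\<^sub>R y = a *\<^sub>R (x * y)"
    by (simp_all add: quat_eq_iff scaleR_quat_def times_quat_def algebra_simps)
  show "x div y = x * inverse y"
    by (rule divide_quat_def)
  show "inverse (0 :: quat) = 0"
    by (simp add: quat_eq_iff inverse_quat_def scaleR_quat_def q_conj_def zero_quat_def)
next
  fix x :: quat
  assume "x \<noteq> 0"
  then have nz: "q_norm2 x \<noteq> 0"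
    by (simp add: q_norm2_eq_0_iff)
  have *: "x * (a *\<^sub>R q_conj x) = Quat (a * q_norm2 x) 0 0 0"
    "(a *\<^sub>R q_conj x) * x = Quat (a * q_norm2 x) 0 0 0" for a
    by (simp_all add: quat_eq_iff times_quat_def scaleR_quat_def q_conj_def q_norm2_def
        power2_eq_square algebra_simps)
  show "inverse x * x = 1" "x * inverse x = 1"
    using nz by (simp_all add: inverse_quat_def * one_quat_def)
qed

end

(* Quaternion-valued; Tr_eq identifies it with the real number 2 Re x. *)
definition Tr :: "quat \<Rightarrow> quat" where
  "Tr x = x + q_conj x"

lemma Tr_eq: "Tr x = of_real (2 * q_re x)"
  by (simp add: Tr_def quat_eq_iff plus_quat_def q_conj_def of_real_def scaleR_quat_def one_quat_def)

end

theory Submission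
  imports Defs
begin

text \<open>
  There is a nonzero \<open>c\<close> with \<open>c * q_conj x = x * c\<close> and \<open>c * q_conj y = y * c\<close>: if \<open>x\<close> and \<open>y\<close> are
  not both real, a pure quaternion orthogonal to their pure parts, obtained as a commutator.
  Then \<open>w \<mapsto> c * q_conj w * inverse c\<close> is an anti-automorphism that fixes \<open>x\<close> and \<open>y\<close> and preserves
  the trace. Hence a word in \<open>x\<close> and \<open>y\<close> has the same trace as its reversal, and both identities
  compare a word with a cyclic rotation of its reversal.
\<close>

lemma q_conj_mult: "q_conj (a * b) = q_conj b * q_conj a"
  by (simp add: q_conj_def times_quat_def quat_eq_iff algebra_simps)

lemma Tr_mult_commute: "Tr (a * b) = Tr (b * a)"
  by (simp add: Tr_eq times_quat_def algebra_simps)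

lemma Tr_q_conj: "Tr (q_conj a) = Tr a"
  by (simp add: Tr_eq q_conj_def)

text \<open>The commutator is twice the cross product of the pure parts, hence pure and orthogonal
  to both. A pure quaternion anticommutes with any pure quaternion orthogonal to it, so moving it
  past \<open>x\<close> or \<open>y\<close> conjugates them.\<close>

lemma commutator_mult_q_conj:
  fixes x y :: quat
  shows "(x * y - y * x) * q_conj x = x * (x * y - y * x)"
    and "(x * y - y * x) * q_conj y = y * (x * y - y * x)"
  by (simp_all add: q_conj_def times_quat_def minus_quat_def quat_eq_iff algebra_simps)

definition twisted_conj :: "quat \<Rightarrow> quat \<Rightarrow> quat" where
  "twisted_conj c w = c * q_conj w * inverse c"

lemma twisted_conj_mult:
  assumes "c \<noteq> 0"
  shows "twisted_conj c (a * b) = twisted_conj c b * twisted_conj c a"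
proof -
  have "inverse c * (c * z) = z" for z
    using assms by (simp flip: mult.assoc)
  then show ?thesis
    by (simp add: twisted_conj_def q_conj_mult mult.assoc)
qed

lemma Tr_twisted_conj:
  assumes "c \<noteq> 0"
  shows "Tr (twisted_conj c w) = Tr w"
proof -
  have "Tr (twisted_conj c w) = Tr (inverse c * (c * q_conj w))"
    unfolding twisted_conj_def by (rule Tr_mult_commute)
  also have "\<dots> = Tr (q_conj w)"
    using assms by (simp flip: mult.assoc)
  finally show ?thesis
    by (simp add: Tr_q_conj)
qed

lemma twisted_conj_power:
  assumes "c \<noteq> 0" "twisted_conj c x = x"
  shows "twisted_conj c (x ^ k) = x ^ k"
proof (induction k)
  case 0
  have "q_conj 1 = 1"
    by (simp add: q_conj_def one_quat_def)
  with assms(1) show ?case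
    by (simp add: twisted_conj_def)
next
  case (Suc k)
  then show ?case
    using assms by (simp add: twisted_conj_mult power_commutes)
qed

text \<open>Commuting quaternions have parallel pure parts, so what is orthogonal to the pure part
  of a nonreal \<open>x\<close> is orthogonal to that of \<open>y\<close>; for real \<open>x\<close>
  the commutator is 0.\<close>

lemma commutator_mult_q_conj_commuting:
  fixes x y z :: quat
  assumes "x * y = y * x"
  shows "(x * z - z * x) * q_conj y = y * (x * z - z * x)"
proof -
  have cross: "q_j x * q_k y = q_k x * q_j y" "q_k x * q_i y = q_i x * q_k y"
    "q_i x * q_j y = q_j x * q_i y"
    using assms by (simp_all add: times_quat_def algebra_simps)
  \<comment> \<open>This is the scalar triple product of the pure parts of \<open>y\<close>,
    \<open>x\<close>, \<open>z\<close>, the only obstruction to the claim.\<close>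
  have "q_i y * (q_j x * q_k z - q_k x * q_j z) + q_j y * (q_k x * q_i z - q_i x * q_k z)
      + q_k y * (q_i x * q_j z - q_j x * q_i z) = 0"
    using cross by algebra
  then show ?thesis
    by (simp add: q_conj_def times_quat_def minus_quat_def quat_eq_iff algebra_simps)
qed

lemma q_conj_central:
  fixes x :: quat
  assumes "\<And>z. x * z = z * x"
  shows "q_conj x = x"
  \<comment> \<open>Commuting with i kills the j and k components, commuting with j the i
    component.\<close>
  using assms[of "Quat 0 1 0 0"] assms[of "Quat 0 0 1 0"]
  by (simp add: q_conj_def times_quat_def quat_eq_iff)

lemma fixing_twisted_conj_exists:
  fixes x y :: quat
  obtains c where "c \<noteq> 0" "twisted_conj c x = x" "twisted_conj c y = y"
proof -
  have fixed: "twisted_conj c w = w" if "c \<noteq> 0" "c * q_conj w = w * c" for c w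
    using that by (simp add: twisted_conj_def mult.assoc)
  \<comment> \<open>Each of the first three cases supplies a nonzero commutator as \<open>c\<close>.
    In the last, \<open>x\<close> and \<open>y\<close> are central, hence real, and
    \<open>c = 1\<close> serves.\<close>
  consider "x * y \<noteq> y * x" | z where "x * y = y * x" "x * z \<noteq> z * x"
    | z where "x * y = y * x" "y * z \<noteq> z * y"
    | "\<And>z. x * z = z * x" "\<And>z. y * z = z * y"
    by blast
  then show thesis
  proof cases
    case 1
    then show thesis
      by (intro that[of "x * y - y * x"] fixed) (simp_all add: commutator_mult_q_conj)
  next
    case (2 z)
    then show thesis
      by (intro that[of "x * z - z * x"] fixed)
        (simp_all add: commutator_mult_q_conj commutator_mult_q_conj_commuting)
  next
    case (3 z)
    then show thesis
      by (intro that[of "y * z - z * y"] fixed)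
        (simp_all add: commutator_mult_q_conj commutator_mult_q_conj_commuting)
  next
    case 4
    then show thesis
      by (intro that[of 1] fixed) (simp_all add: q_conj_central)
  qed
qed

lemma Tr_reverse:
  fixes x y :: quat
  shows "Tr (x ^ i * y ^ j * x ^ k * y ^ l) = Tr (y ^ l * x ^ k * y ^ j * x ^ i)"
    and "Tr (x ^ i * y ^ j * x ^ k * y ^ l * x ^ p * y ^ q) =
      Tr (y ^ q * x ^ p * y ^ l * x ^ k * y ^ j * x ^ i)"
proof -
  obtain c where c: "c \<noteq> 0" "twisted_conj c x = x" "twisted_conj c y = y"
    by (rule fixing_twisted_conj_exists)
  note simps = twisted_conj_mult twisted_conj_power mult.assoc
  show "Tr (x ^ i * y ^ j * x ^ k * y ^ l) = Tr (y ^ l * x ^ k * y ^ j * x ^ i)"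
    by (subst Tr_twisted_conj[OF c(1), symmetric]) (simp add: c simps)
  show "Tr (x ^ i * y ^ j * x ^ k * y ^ l * x ^ p * y ^ q) =
      Tr (y ^ q * x ^ p * y ^ l * x ^ k * y ^ j * x ^ i)"
    by (subst Tr_twisted_conj[OF c(1), symmetric]) (simp add: c simps)
qed

theorem corollary4p3:
  fixes m n r :: nat
  shows "(\<forall>x y :: quat. Tr (x ^ m * y ^ m * x ^ n * y ^ n) = Tr (y ^ m * x ^ m * y ^ n * x ^ n)) \<and>
    (m = n \<or> n = r \<or> m = r \<longrightarrow>
      (\<forall>x y :: quat. Tr (x ^ m * y ^ m * x ^ n * y ^ n * x ^ r * y ^ r) =
        Tr (y ^ m * x ^ m * y ^ n * x ^ n * y ^ r * x ^ r)))"
proof (intro conjI impI allI)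
  fix x y :: quat
  have "Tr (x ^ m * y ^ m * x ^ n * y ^ n) = Tr ((y ^ n * x ^ n) * (y ^ m * x ^ m))"
    by (subst Tr_reverse(1)) (simp add: mult.assoc)
  also have "\<dots> = Tr ((y ^ m * x ^ m) * (y ^ n * x ^ n))"
    by (rule Tr_mult_commute)
  finally show "Tr (x ^ m * y ^ m * x ^ n * y ^ n) = Tr (y ^ m * x ^ m * y ^ n * x ^ n)"
    by (simp add: mult.assoc)
next
  fix x y :: quat
  assume eq: "m = n \<or> n = r \<or> m = r"
  define b where "b = (\<lambda>k. y ^ k * x ^ k)"
  have "Tr (x ^ m * y ^ m * x ^ n * y ^ n * x ^ r * y ^ r) = Tr (b r * b n * b m)"
    by (subst Tr_reverse(2)) (simp add: b_def mult.assoc)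
  \<comment> \<open>With two equal indices, reversing the three blocks amounts to a cyclic
    rotation.\<close>
  also have "\<dots> = Tr (b m * b n * b r)"
    using eq Tr_mult_commute[of "b r" "b n * b m"] Tr_mult_commute[of "b r * b n" "b m"]
    by (auto simp: mult.assoc)
  finally show "Tr (x ^ m * y ^ m * x ^ n * y ^ n * x ^ r * y ^ r) =
      Tr (y ^ m * x ^ m * y ^ n * x ^ n * y ^ r * x ^ r)"
    by (simp add: b_def mult.assoc)
qed

end
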